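(* Let $A$ and $E$ be real symmetric $n\times n$ matrices with $E\ne 0$, $\tilde A=A+E$, and let $D\subset\mathbb R$ be a region with $\delta_D>0$. Assume that for some $K>0$, $$\delta_D\ \ge\ 6\max\left\{\frac{\|E\|}{K},\ \sqrt{r_K\,x\,\|E\|}\right\}.$$ (i) If $\delta_D\ge\|E\|$, then $$\|\tilde\Pi_D-\Pi_D\|\ \le\ 44\log\!\left(3+\frac{\sigma_1}{\|E\|}\right)\cdot C_D\cdot\left(\frac{r_K\,x}{\delta_D}+\frac1K\right).$$ (ii) If $\delta_D<\|E\|$, then $$\|\tilde\Pi_D-\Pi_D\|\ \le\ 44\log\!\left(3+\frac{\sigma_1}{\delta_D}\right)\cdot C_D\cdot\left(\frac{\|E\|}{K\delta_D}+\frac{r_K\,x\,\|E\|}{\delta_D^2}\right).$$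
   Context: $\|\cdot\|$ is the spectral norm; $\log$ is natural. $A$ has eigenvalues $\lambda_1\ge\dots\ge\lambda_n$ (with multiplicity) and a fixed orthonormal eigenbasis $u_1,\dots,u_n$ (any choice is allowed when eigenvalues are multiple); $\sigma_1=\|A\|$ is the largest singular value of $A$. Directional perturbation: $x:=\max_{1\le i,j\le n}|u_i^\top E u_j|$. A region is the union of a finite number of disjoint open intervals of the real line (unbounded intervals such as $(a,+\infty)$ are allowed). $C_D$ is the number of connected components of $D$, $\partial D$ its boundary, and $\delta_D:=\min_{1\le i\le n}\operatorname{dist}(\lambda_i,\partial D)$. For $K>0$, $r_K$ is the number of eigenvalues of $A$, counted with multiplicity, whose distance from $D$ is at most $K\|E\|$. $\Pi_D$ (resp. $\tilde\Pi_D$) is the orthogonal projection onto the span of the eigenvectors of $A$ (resp. $\tilde A$) corresponding to eigenvalues lying in $D$. *)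

theory Defs
  imports "HOL-Analysis.Analysis" "HOL-Library.Extended_Real"
begin

definition spectral_norm :: "real^'n^'m \<Rightarrow> real" where
  "spectral_norm M = onorm ((*v) M)"

text \<open>
  Since the family is indexed by the index type of the matrix, an orthonormal family of
  eigenvectors is a basis, and \<open>lam\<close> lists the eigenvalues with multiplicity.
\<close>

definition orthonormal_eigenbasis ::
    "real^'n^'n \<Rightarrow> ('n \<Rightarrow> real) \<Rightarrow> ('n \<Rightarrow> real^'n) \<Rightarrow> bool" where
  "orthonormal_eigenbasis A lam u \<longleftrightarrow>
     (\<forall>i j. u i \<bullet> u j = (if i = j then 1 else 0)) \<and> (\<forall>i. A *v u i = lam i *\<^sub>R u i)"

definition dir_pert :: "('n \<Rightarrow> real^'n) \<Rightarrow> real^'n^'n \<Rightarrow> real" where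
  "dir_pert u E = Max {\<bar>u i \<bullet> (E *v u j)\<bar> |i j. True}"

definition is_region :: "real set \<Rightarrow> bool" where
  "is_region D \<longleftrightarrow>
     (\<exists>\<I>. finite \<I> \<and> disjoint \<I> \<and> (\<forall>I\<in>\<I>. open I \<and> is_interval I) \<and> D = \<Union>\<I>)"

text \<open>
  The distance to the empty set is \<open>\<infinity>\<close>, whereas \<open>infdist\<close> and \<open>setdist\<close> give \<open>0\<close> there.
  This matters for the region \<open>UNIV\<close>, whose boundary is empty.
\<close>

definition set_edist :: "real \<Rightarrow> real set \<Rightarrow> ereal" where
  "set_edist t S = (INF s\<in>S. ereal (dist t s))"

definition boundary_gap :: "('n::finite \<Rightarrow> real) \<Rightarrow> real set \<Rightarrow> ereal" where
  "boundary_gap lam D = Min (range (\<lambda>i. set_edist (lam i) (frontier D)))"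

definition num_components :: "real set \<Rightarrow> nat" where
  "num_components D = card (components D)"

definition near_count :: "('n \<Rightarrow> real) \<Rightarrow> real set \<Rightarrow> real \<Rightarrow> nat" where
  "near_count lam D \<rho> = card {i. set_edist (lam i) D \<le> ereal \<rho>}"

definition orth_proj :: "'a::euclidean_space set \<Rightarrow> 'a \<Rightarrow> 'a" where
  "orth_proj S v = (THE p. p \<in> S \<and> (\<forall>s\<in>S. orthogonal (v - p) s))"

definition spectral_proj :: "real^'n^'n \<Rightarrow> real set \<Rightarrow> real^'n^'n" where
  "spectral_proj M D =
     matrix (orth_proj (span {v. v \<noteq> 0 \<and> (\<exists>\<mu>\<in>D. M *v v = \<mu> *\<^sub>R v)}))"

lemma orth_proj_unique:
  fixes S :: "'a::euclidean_space set"
  assumes "subspace S" "p \<in> S" "\<And>s. s \<in> S \<Longrightarrow> orthogonal (v - p) s"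
  shows "orth_proj S v = p"
  unfolding orth_proj_def
proof (rule the_equality)
  show "p \<in> S \<and> (\<forall>s\<in>S. orthogonal (v - p) s)"
    using assms by blast
next
  fix q assume q: "q \<in> S \<and> (\<forall>s\<in>S. orthogonal (v - q) s)"
  have d: "q - p \<in> S"
    using q assms(1,2) by (simp add: subspace_diff)
  have "(v - p) \<bullet> (q - p) = 0" "(v - q) \<bullet> (q - p) = 0"
    using q assms(3) d by (auto simp: orthogonal_def)
  then have "(q - p) \<bullet> (q - p) = 0"
    by (simp add: inner_diff_left)
  then show "q = p" by simp
qed

lemma orth_proj_works:
  fixes S :: "'a::euclidean_space set"
  assumes "subspace S"
  shows "orth_proj S v \<in> S" and "s \<in> S \<Longrightarrow> orthogonal (v - orth_proj S v) s"
proof -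
  obtain y z where y: "y \<in> span S" and z: "\<And>w. w \<in> span S \<Longrightarrow> orthogonal z w" and v: "v = y + z"
    using orthogonal_subspace_decomp_exists[of S v] by metis
  have sp: "span S = S"
    using assms by (simp add: span_eq_iff)
  have p: "orth_proj S v = y"
    using y z v assms unfolding sp by (intro orth_proj_unique) auto
  show "orth_proj S v \<in> S"
    using p y sp by simp
  show "s \<in> S \<Longrightarrow> orthogonal (v - orth_proj S v) s"
    using p z v sp by simp
qed

lemma linear_orth_proj:
  fixes S :: "'a::euclidean_space set"
  assumes S: "subspace S"
  shows "linear (orth_proj S)"
proof (rule linearI)
  note w = orth_proj_works[OF S]
  show "orth_proj S (x + y) = orth_proj S x + orth_proj S y" for x y
  proof (rule orth_proj_unique[OF S])
    show "orth_proj S x + orth_proj S y \<in> S"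
      using w(1) S by (simp add: subspace_add)
    fix s assume "s \<in> S"
    then show "orthogonal (x + y - (orth_proj S x + orth_proj S y)) s"
      using w(2)[of s x] w(2)[of s y] by (simp add: orthogonal_def inner_diff_left inner_add_left)
  qed
  show "orth_proj S (c *\<^sub>R x) = c *\<^sub>R orth_proj S x" for c x
  proof (rule orth_proj_unique[OF S])
    show "c *\<^sub>R orth_proj S x \<in> S"
      using w(1) S by (simp add: subspace_scale)
    fix s assume "s \<in> S"
    then show "orthogonal (c *\<^sub>R x - c *\<^sub>R orth_proj S x) s"
      using w(2)[of s x] by (simp add: orthogonal_def inner_diff_left)
  qed
qed

end

(*
  No contour integral is needed: the bound holds with 4 in place of 44 log(...).

  Let C be a component of D, and P, Q the spectral projections of A and B = A + E onto C.
  The numbers mu_j in C lie in an interval at distance at least delta_D from every lambda_i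
  outside C, so a Davis--Kahan argument bounds (1 - P) Q. Split the eigenvectors of A into the
  r_K near ones and the rest. The far part of (1 - P) Q is at most 1/K; on the near
  coordinates E has norm at most r_K x, so the near part is at most
  (r_K x + ||E||/K) / delta_D. Let s be the sum of the two bounds.

  To pass from (1 - P) Q to P - Q, compare ranks. On the near coordinates the quadratic form
  of E is bounded by min(r_K x, ||E||) <= sqrt(r_K x ||E||) <= delta_D / 6, and the cross terms
  are absorbed by the far gap K ||E||. So B has no more eigenvalues than A beyond each
  endpoint of C, and rank Q >= rank P. Either s >= 1, or P is injective on the range of Q, hence maps it onto
  the range of P, and then ||(1 - Q) P|| <= s as well. This gives ||P - Q|| <= 2 s;
  sum over the components.
*)
theory Submission
  imports Defs
begin

section \<open>Coordinate projections of an orthonormal basis\<close>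

locale orthonormal_basis =
  fixes u :: "'n::finite \<Rightarrow> real^'n"
  assumes orthonormal: "u i \<bullet> u j = (if i = j then 1 else 0)"
begin

text \<open>The orthogonal projection onto the span of the \<open>u i\<close> with
  \<open>i \<in> J\<close>, see \<open>orth_proj_span\<close>. Indexing by sets turns products of
  projections into intersections.\<close>

definition pr :: "'n set \<Rightarrow> real^'n \<Rightarrow> real^'n" where
  "pr J v = (\<Sum>i\<in>J. (u i \<bullet> v) *\<^sub>R u i)"

lemma inj: "inj u"
proof (rule injI)
  fix i j assume "u i = u j"
  then show "i = j"
    using orthonormal[of i j] orthonormal[of j j] by (auto split: if_splits)
qed

lemma independent_image: "independent (u ` J)"
proof (rule pairwise_orthogonal_independent)
  show "pairwise orthogonal (u ` J)"
    using orthonormal by (auto simp: pairwise_def orthogonal_def)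
  show "0 \<notin> u ` J"
    using orthonormal by (metis image_iff inner_zero_left zero_neq_one)
qed

lemma dim_span_image: "dim (span (u ` J)) = card J"
  using independent_image[of J] inj
  by (simp add: dim_eq_card_independent card_image inj_on_subset)

lemma linear_pr: "linear (pr J)"
  by (rule linearI)
    (simp_all add: pr_def inner_add_right scaleR_left_distrib sum.distrib scaleR_sum_right)

lemmas bounded_linear_pr = linear_pr[THEN linear_conv_bounded_linear[THEN iffD1]]

lemma pr_add: "pr J (v + w) = pr J v + pr J w"
  and pr_diff: "pr J (v - w) = pr J v - pr J w"
  and pr_scale: "pr J (c *\<^sub>R v) = c *\<^sub>R pr J v"
  using linear_pr[of J] by (rule linear_add linear_diff linear_cmul)+

lemma inner_pr: "u k \<bullet> pr J v = (if k \<in> J then u k \<bullet> v else 0)"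
proof -
  have "u k \<bullet> pr J v = (\<Sum>i\<in>J. if k = i then u i \<bullet> v else 0)"
    unfolding pr_def inner_sum_right by (rule sum.cong) (auto simp: orthonormal)
  then show ?thesis by simp
qed

lemma pr_in_span: "pr J v \<in> span (u ` J)"
  unfolding pr_def by (intro span_sum span_scale span_base) auto

lemma span_UNIV: "span (range u) = UNIV"
proof -
  have "dim (range u) = DIM(real^'n)"
    using dim_span_image[of UNIV] by (simp add: dim_span)
  then show ?thesis
    by (rule dim_eq_full[THEN iffD1])
qed

lemma pr_inner_commute: "pr J v \<bullet> w = v \<bullet> pr J w"
  by (simp add: pr_def inner_sum_left inner_sum_right inner_commute mult.commute)

lemma pr_span: "v \<in> span (u ` J) \<Longrightarrow> pr J v = v"
proof (induction rule: span_induct_alt)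
  case base
  show ?case by (simp add: pr_def)
next
  case (step c x y)
  then obtain k where k: "k \<in> J" "x = u k" by auto
  have "pr J x = (\<Sum>i\<in>J. if k = i then u i else 0)"
    unfolding pr_def k by (rule sum.cong) (auto simp: orthonormal)
  then have "pr J x = x" using k by simp
  then show ?case using step by (simp add: pr_add pr_scale)
qed

lemma pr_UNIV: "pr UNIV v = v"
  using pr_span[of v UNIV] span_UNIV by simp

lemma pr_union: "J \<inter> L = {} \<Longrightarrow> pr (J \<union> L) v = pr J v + pr L v"
  unfolding pr_def by (rule sum.union_disjoint) auto

lemma pr_compl: "pr J v + pr (- J) v = v"
  using pr_union[of J "- J" v] pr_UNIV by (simp add: Compl_partition)

lemma coeff_eqI: "(\<And>i. u i \<bullet> v = u i \<bullet> w) \<Longrightarrow> v = w"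
  using pr_UNIV[of v] pr_UNIV[of w] by (simp add: pr_def)

lemma pr_pr: "pr J (pr L v) = pr (J \<inter> L) v"
  by (rule coeff_eqI) (simp add: inner_pr)

lemma norm_pr_square: "(norm (pr J v))\<^sup>2 = (\<Sum>i\<in>J. (u i \<bullet> v)\<^sup>2)"
proof -
  have "(norm (pr J v))\<^sup>2 = v \<bullet> pr J v"
    by (simp add: power2_norm_eq_inner pr_inner_commute pr_pr)
  then show ?thesis
    by (simp add: pr_def inner_sum_right power2_eq_square inner_commute)
qed

lemma norm_square: "(norm v)\<^sup>2 = (\<Sum>i\<in>UNIV. (u i \<bullet> v)\<^sup>2)"
  using norm_pr_square[of UNIV v] by (simp add: pr_UNIV)

lemma norm_pr_mono: "J \<subseteq> L \<Longrightarrow> norm (pr J v) \<le> norm (pr L v)"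
  by (rule power2_le_imp_le) (auto simp: norm_pr_square intro!: sum_mono2)

lemma norm_pr_le: "norm (pr J v) \<le> norm v"
  using norm_pr_mono[of J UNIV v] by (simp add: pr_UNIV)

lemma orth_proj_span: "orth_proj (span (u ` J)) v = pr J v"
proof (rule orth_proj_unique)
  fix s assume "s \<in> span (u ` J)"
  then have s: "s = pr J s" by (simp add: pr_span)
  have "(v - pr J v) \<bullet> s = pr J (v - pr J v) \<bullet> s"
    by (subst s) (simp add: pr_inner_commute)
  then show "orthogonal (v - pr J v) s"
    by (simp add: orthogonal_def pr_diff pr_pr)
qed (auto simp: pr_in_span)

lemma sum_abs_coeff_le: "(\<Sum>i\<in>J. \<bar>u i \<bullet> v\<bar>) \<le> sqrt (card J) * norm (pr J v)"
proof -
  have "(\<Sum>i\<in>J. \<bar>u i \<bullet> v\<bar>)\<^sup>2 \<le> card J * (\<Sum>i\<in>J. (u i \<bullet> v)\<^sup>2)"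
    using Cauchy_Schwarz_ineq_sum[of "\<lambda>_. 1" "\<lambda>i. \<bar>u i \<bullet> v\<bar>" J] by simp
  also have "\<dots> = (sqrt (card J) * norm (pr J v))\<^sup>2"
    by (simp add: norm_pr_square power_mult_distrib)
  finally show ?thesis by (rule power2_le_imp_le) simp
qed

text \<open>Every entry of the block is at most \<open>x\<close>, and Cauchy-Schwarz costs a factor
  \<open>sqrt (card J)\<close> on each side. With \<open>J\<close> the near indices this is the
  source of r_K x in the theorem.\<close>

lemma bilinear_block_bound:
  fixes x :: real
  assumes x: "\<And>i j. \<bar>u i \<bullet> (E *v u j)\<bar> \<le> x"
  shows "\<bar>pr J v \<bullet> (E *v pr J w)\<bar> \<le> card J * x * norm (pr J v) * norm (pr J w)"
proof -
  have x0: "0 \<le> x" using x[of undefined undefined] by linarith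
  have inner: "u i \<bullet> (E *v pr J w) = (\<Sum>j\<in>J. (u j \<bullet> w) * (u i \<bullet> (E *v u j)))" for i
    by (simp add: pr_def inner_sum_right matrix_vector_mult_scaleR
        linear_sum[OF matrix_vector_mul_linear])
  have "pr J v \<bullet> (E *v pr J w) = (\<Sum>i\<in>J. (u i \<bullet> v) * (u i \<bullet> (E *v pr J w)))"
    by (simp add: pr_def[of J v] inner_sum_left)
  also have "\<dots> = (\<Sum>i\<in>J. \<Sum>j\<in>J. (u i \<bullet> v) * (u j \<bullet> w) * (u i \<bullet> (E *v u j)))"
    by (simp add: inner sum_distrib_left mult.assoc)
  finally have "\<bar>pr J v \<bullet> (E *v pr J w)\<bar> = \<bar>\<Sum>i\<in>J. \<Sum>j\<in>J. (u i \<bullet> v) * (u j \<bullet> w) * (u i \<bullet> (E *v u j))\<bar>"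
    by simp
  also have "\<dots> \<le> (\<Sum>i\<in>J. \<Sum>j\<in>J. \<bar>u i \<bullet> v\<bar> * \<bar>u j \<bullet> w\<bar> * x)"
    by (rule order_trans[OF sum_abs], intro sum_mono, rule order_trans[OF sum_abs])
      (auto simp: abs_mult intro!: sum_mono mult_left_mono x)
  also have "\<dots> = (\<Sum>i\<in>J. \<bar>u i \<bullet> v\<bar>) * (\<Sum>i\<in>J. \<bar>u i \<bullet> w\<bar>) * x"
    unfolding sum_product by (simp only: sum_distrib_right)
  also have "\<dots> \<le> (sqrt (card J) * norm (pr J v)) * (sqrt (card J) * norm (pr J w)) * x"
    by (intro mult_right_mono mult_mono sum_abs_coeff_le x0) (auto intro: sum_nonneg)
  also have "\<dots> = (sqrt (card J) * sqrt (card J)) * x * norm (pr J v) * norm (pr J w)"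
    by (simp only: mult_ac)
  finally show ?thesis by simp
qed

end

section \<open>Spectral projections and shifted norms in an eigenbasis\<close>

locale eigenbasis = orthonormal_basis u for u :: "'n::finite \<Rightarrow> real^'n" +
  fixes A :: "real^'n^'n" and lam :: "'n \<Rightarrow> real"
  assumes eigen: "A *v u i = lam i *\<^sub>R u i"
begin

text \<open>Being diagonal in an orthonormal basis takes the place of symmetry in this
  locale.\<close>

lemma inner_mult: "u i \<bullet> (A *v v) = lam i * (u i \<bullet> v)"
proof -
  have "A *v v = A *v (\<Sum>j\<in>UNIV. (u j \<bullet> v) *\<^sub>R u j)"
    using pr_UNIV[of v] by (simp add: pr_def)
  also have "\<dots> = (\<Sum>j\<in>UNIV. (u j \<bullet> v) *\<^sub>R lam j *\<^sub>R u j)"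
    by (simp add: linear_sum[OF matrix_vector_mul_linear] matrix_vector_mult_scaleR eigen)
  finally have "u i \<bullet> (A *v v) = (\<Sum>j\<in>UNIV. u j \<bullet> v * lam j * (if i = j then 1 else 0))"
    by (simp add: inner_sum_right orthonormal)
  also have "\<dots> = (\<Sum>j\<in>UNIV. if i = j then u j \<bullet> v * lam j else 0)"
    by (rule sum.cong) auto
  finally show ?thesis by simp
qed

lemma pr_mult: "pr J (A *v v) = A *v pr J v"
  by (rule coeff_eqI) (simp add: inner_mult inner_pr)

text \<open>An eigenvector for \<open>\<mu>\<close> has zero coefficient at every \<open>u i\<close>
  with \<open>lam i \<noteq> \<mu>\<close>. Hence \<open>spectral_proj\<close> can be computed in
  any eigenbasis, also when eigenvalues are multiple.\<close>

lemma span_eigenvectors: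
  "span {v. v \<noteq> 0 \<and> (\<exists>\<mu>\<in>D. A *v v = \<mu> *\<^sub>R v)} = span (u ` {i. lam i \<in> D})"
proof (rule antisym; rule span_minimal)
  show "{v. v \<noteq> 0 \<and> (\<exists>\<mu>\<in>D. A *v v = \<mu> *\<^sub>R v)} \<subseteq> span (u ` {i. lam i \<in> D})"
  proof clarify
    fix v \<mu> assume \<mu>: "\<mu> \<in> D" "A *v v = \<mu> *\<^sub>R v"
    have "u i \<bullet> v = 0" if "lam i \<notin> D" for i
      using inner_mult[of i v] \<mu> that by auto
    then have "pr {i. lam i \<in> D} v = v"
      by (intro coeff_eqI) (simp add: inner_pr)
    then show "v \<in> span (u ` {i. lam i \<in> D})"
      by (metis pr_in_span)
  qed
  show "u ` {i. lam i \<in> D} \<subseteq> span {v. v \<noteq> 0 \<and> (\<exists>\<mu>\<in>D. A *v v = \<mu> *\<^sub>R v)}"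
  proof (clarify, rule span_base, clarify)
    fix i assume "lam i \<in> D"
    moreover have "u i \<noteq> 0" using orthonormal[of i i] by auto
    ultimately show "u i \<noteq> 0 \<and> (\<exists>\<mu>\<in>D. A *v u i = \<mu> *\<^sub>R u i)"
      using eigen by blast
  qed
qed (auto simp: subspace_span)

lemma spectral_proj_mult: "spectral_proj A D *v v = pr {i. lam i \<in> D} v"
  unfolding spectral_proj_def span_eigenvectors
  by (simp add: matrix_works linear_orth_proj orth_proj_span linear_linear)

lemma spectral_proj_UNION:
  assumes "finite \<C>" "disjoint \<C>"
  shows "spectral_proj A (\<Union>\<C>) = (\<Sum>C\<in>\<C>. spectral_proj A C)"
  using assms
proof (induction \<C>)
  case empty
  show ?case by (auto simp: matrix_eq spectral_proj_mult pr_def)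
next
  case (insert C \<C>)
  have "C \<inter> \<Union>\<C> = {}"
    using insert.prems insert.hyps(2) by (auto simp: disjoint_def pairwise_def disjnt_def)
  then have "pr ({i. lam i \<in> C} \<union> {i. lam i \<in> \<Union>\<C>}) v
      = pr {i. lam i \<in> C} v + pr {i. lam i \<in> \<Union>\<C>} v" for v
    by (intro pr_union) auto
  moreover have "{i. lam i \<in> \<Union>(insert C \<C>)} = {i. lam i \<in> C} \<union> {i. lam i \<in> \<Union>\<C>}"
    by auto
  ultimately have "spectral_proj A (\<Union>(insert C \<C>)) = spectral_proj A C + spectral_proj A (\<Union>\<C>)"
    by (simp add: matrix_eq matrix_vector_mult_add_rdistrib spectral_proj_mult)
  moreover have "disjoint \<C>"
    using insert.prems by (simp add: disjoint_def pairwise_insert)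
  ultimately show ?case using insert by simp
qed

lemma quadratic_form: "v \<bullet> (A *v v) = (\<Sum>i\<in>UNIV. lam i * (u i \<bullet> v)\<^sup>2)"
proof -
  have "v \<bullet> (A *v v) = pr UNIV v \<bullet> (A *v v)" by (simp add: pr_UNIV)
  also have "\<dots> = (\<Sum>i\<in>UNIV. lam i * (u i \<bullet> v)\<^sup>2)"
    by (simp add: pr_def inner_sum_left inner_mult power2_eq_square mult_ac)
  finally show ?thesis .
qed

text \<open>On the coordinates in \<open>J\<close> the shift of \<open>A\<close> by \<open>c\<close>
  is diagonal with entries of modulus at least \<open>d\<close>. Together with
  \<open>norm_shift_le\<close> this yields the two sides of the estimate in
  \<open>davis_kahan\<close>.\<close>

lemma norm_shift_ge:
  assumes "\<And>i. i \<in> J \<Longrightarrow> d \<le> \<bar>lam i - c\<bar>" "0 \<le> d"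
  shows "d * norm (pr J v) \<le> norm (pr J (A *v v - c *\<^sub>R v))"
proof (rule power2_le_imp_le)
  have "(d * norm (pr J v))\<^sup>2 = (\<Sum>i\<in>J. d\<^sup>2 * (u i \<bullet> v)\<^sup>2)"
    by (simp add: power_mult_distrib norm_pr_square sum_distrib_left)
  also have "\<dots> \<le> (\<Sum>i\<in>J. (lam i - c)\<^sup>2 * (u i \<bullet> v)\<^sup>2)"
    using assms by (intro sum_mono mult_right_mono) (auto simp: abs_le_square_iff[symmetric])
  also have "\<dots> = (norm (pr J (A *v v - c *\<^sub>R v)))\<^sup>2"
    by (simp add: norm_pr_square inner_diff_right inner_mult power_mult_distrib[symmetric]
        left_diff_distrib)
  finally show "(d * norm (pr J v))\<^sup>2 \<le> (norm (pr J (A *v v - c *\<^sub>R v)))\<^sup>2" .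
qed simp

lemma norm_shift_le:
  assumes "\<And>i. i \<in> J \<Longrightarrow> \<bar>lam i - c\<bar> \<le> d" "0 \<le> d"
  shows "norm (pr J (A *v v - c *\<^sub>R v)) \<le> d * norm (pr J v)"
proof (rule power2_le_imp_le)
  have "(norm (pr J (A *v v - c *\<^sub>R v)))\<^sup>2 = (\<Sum>i\<in>J. (lam i - c)\<^sup>2 * (u i \<bullet> v)\<^sup>2)"
    by (simp add: norm_pr_square inner_diff_right inner_mult power_mult_distrib[symmetric]
        left_diff_distrib)
  also have "\<dots> \<le> (\<Sum>i\<in>J. d\<^sup>2 * (u i \<bullet> v)\<^sup>2)"
    using assms by (intro sum_mono mult_right_mono) (auto simp: abs_le_square_iff[symmetric])
  also have "\<dots> = (d * norm (pr J v))\<^sup>2"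
    by (simp add: power_mult_distrib norm_pr_square sum_distrib_left)
  finally show "(norm (pr J (A *v v - c *\<^sub>R v)))\<^sup>2 \<le> (d * norm (pr J v))\<^sup>2" .
qed (use assms in simp)

end

lemma orthonormal_eigenbasis_iff: "orthonormal_eigenbasis A lam u \<longleftrightarrow> eigenbasis u A lam"
  by (auto simp: orthonormal_eigenbasis_def orthonormal_basis_def eigenbasis_def
      eigenbasis_axioms_def)

section \<open>Diagonalization of symmetric matrices\<close>

lemma symmetric_matrix_inner:
  fixes A :: "real^'n^'n"
  assumes "transpose A = A"
  shows "(A *v v) \<bullet> w = v \<bullet> (A *v w)"
  using assms by (metis dot_lmul_matrix inner_commute transpose_matrix_vector)

text \<open>A maximizer of the quadratic form on the unit sphere of \<open>S\<close> is an
  eigenvector, with the maximum as eigenvalue. Invariance puts the residual \<open>y\<close> into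
  \<open>S\<close>, where it is an admissible direction of variation.\<close>

lemma symmetric_eigenvector_exists:
  fixes A :: "real^'n^'n"
  assumes A: "transpose A = A" and S: "subspace S" "S \<noteq> {0}"
    and inv: "\<And>v. v \<in> S \<Longrightarrow> A *v v \<in> S"
  obtains v c where "v \<in> S" "norm v = 1" "A *v v = c *\<^sub>R v"
proof -
  let ?q = "\<lambda>v. v \<bullet> (A *v v)"
  let ?K = "S \<inter> sphere 0 1"
  obtain z where z: "z \<in> S" "z \<noteq> 0"
    using S subspace_0 by blast
  then have "(1 / norm z) *\<^sub>R z \<in> ?K"
    using S(1) by (simp add: subspace_scale)
  moreover have "compact ?K"
    using S(1) by (simp add: closed_Int_compact closed_subspace)
  moreover have "continuous_on ?K ?q"
    by (intro continuous_intros linear_continuous_on matrix_vector_mul_bounded_linear)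
  ultimately obtain v where v: "v \<in> ?K" and max: "\<And>y. y \<in> ?K \<Longrightarrow> ?q y \<le> ?q v"
    using continuous_attains_sup[of ?K ?q] by blast
  define c where "c = ?q v"
  have nonneg: "?q y \<le> c * (y \<bullet> y)" if "y \<in> S" for y
  proof (cases "y = 0")
    case False
    have "?q ((1 / norm y) *\<^sub>R y) \<le> c"
      unfolding c_def using False that S(1) by (intro max) (simp add: subspace_scale)
    then have "?q y / (norm y)\<^sup>2 \<le> c"
      by (simp add: matrix_vector_mult_scaleR power2_eq_square)
    then show ?thesis
      using False by (simp add: divide_le_eq dot_square_norm)
  qed simp
  have v1: "v \<bullet> v = 1" using v by (simp add: dot_square_norm)
  define y where "y = c *\<^sub>R v - A *v v"
  have yS: "y \<in> S"
    unfolding y_def using v inv S(1) by (auto intro: subspace_diff subspace_scale)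
  text \<open>The form \<open>c * (z \<bullet> z) - ?q z\<close> is nonnegative on \<open>S\<close> and vanishes at \<open>v\<close>,
    so its derivative at \<open>v\<close> in the direction \<open>y\<close>, which is \<open>2 * (y \<bullet> y)\<close>, is zero.\<close>
  define k where "k = c * (y \<bullet> y) - ?q y"
  have quad: "0 \<le> 2 * t * (y \<bullet> y) + t\<^sup>2 * k" for t
  proof -
    have "v + t *\<^sub>R y \<in> S" using v yS S(1) by (simp add: subspace_add subspace_scale)
    from nonneg[OF this]
    have "0 \<le> c * (v \<bullet> v) - ?q v + 2 * t * (c * (v \<bullet> y) - y \<bullet> (A *v v)) + t\<^sup>2 * k"
      using symmetric_matrix_inner[OF A, of v y]
      by (simp add: k_def inner_add_left inner_add_right matrix_vector_right_distrib
          matrix_vector_mult_scaleR power2_eq_square algebra_simps inner_commute)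
    moreover have "c * (v \<bullet> y) - y \<bullet> (A *v v) = y \<bullet> y"
      by (simp add: y_def inner_diff_right inner_diff_left inner_commute algebra_simps)
    ultimately show ?thesis using v1 by (simp add: c_def)
  qed
  have "y \<bullet> y = 0"
  proof (rule ccontr)
    assume "y \<bullet> y \<noteq> 0"
    then have pos: "0 < y \<bullet> y" using inner_ge_zero[of y] by linarith
    have k: "0 \<le> k" unfolding k_def using nonneg[OF yS] by simp
    \<comment> \<open>For this \<open>t\<close> the expression in \<open>quad\<close> equals
      \<open>t * (y \<bullet> y - t)\<close>, a negative times a positive number. The
      \<open>+ 1\<close> keeps the denominator positive when \<open>k = 0\<close>.\<close>
    define t where "t = - (y \<bullet> y) / (k + 1)"
    have "t * (k + 1) = - (y \<bullet> y)" using k by (simp add: t_def)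
    moreover have "t < 0" using pos k by (simp add: t_def)
    moreover have "2 * t * (y \<bullet> y) + t\<^sup>2 * k = t * (2 * (y \<bullet> y) + t * (k + 1) - t)"
      by (simp add: power2_eq_square algebra_simps)
    ultimately show False
      using quad[of t] pos by (smt (verit) mult_neg_pos)
  qed
  then have "A *v v = c *\<^sub>R v" by (simp add: y_def)
  then show thesis using v that by auto
qed

text \<open>Induction on the dimension: split off a unit eigenvector \<open>v\<close>. By symmetry
  its orthogonal complement in \<open>S\<close> is again invariant, and its dimension is one
  less.\<close>

lemma symmetric_eigenbasis_subspace:
  fixes A :: "real^'n^'n"
  assumes A: "transpose A = A" and "subspace S" "\<And>v. v \<in> S \<Longrightarrow> A *v v \<in> S"
  shows "\<exists>B\<subseteq>S. finite B \<and> card B = dim S \<and> pairwise orthogonal B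
    \<and> (\<forall>v\<in>B. norm v = 1 \<and> (\<exists>c. A *v v = c *\<^sub>R v))"
  using assms(2,3)
proof (induction "dim S" arbitrary: S)
  case 0
  then show ?case by (intro exI[of _ "{}"]) simp
next
  case (Suc k)
  have "S \<noteq> {0}" using Suc.hyps(2) by auto
  with A Suc.prems obtain v c where v: "v \<in> S" "norm v = 1" "A *v v = c *\<^sub>R v"
    using symmetric_eigenvector_exists[of A S] by metis
  define T where "T = S \<inter> {y. v \<bullet> y = 0}"
  have T: "subspace T"
    unfolding T_def using Suc.prems(1) by (intro subspace_inter subspace_hyperplane)
  have inv: "A *v y \<in> T" if "y \<in> T" for y
    using that Suc.prems(2) symmetric_matrix_inner[OF A, of v y] v(3) by (auto simp: T_def)
  have vT: "v \<notin> T" using v(2) by (auto simp: T_def)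
  have "S \<subseteq> span (insert v T)"
  proof
    fix y assume y: "y \<in> S"
    have "y - (v \<bullet> y) *\<^sub>R v \<in> T"
      using y v Suc.prems(1)
      by (auto simp: T_def inner_diff_right dot_square_norm intro: subspace_diff subspace_scale)
    then show "y \<in> span (insert v T)"
      using span_breakdown_eq[of y v T] span_base[of "y - (v \<bullet> y) *\<^sub>R v" T] by blast
  qed
  moreover have "span (insert v T) \<subseteq> S"
    using v(1) Suc.prems(1) by (intro span_minimal) (auto simp: T_def)
  ultimately have "span (insert v T) = S" by (rule subset_antisym[rotated])
  then have "dim S = dim (insert v T)" using dim_span[of "insert v T"] by simp
  moreover have "span T = T" using T by (simp add: span_eq_iff)
  ultimately have dT: "dim S = Suc (dim T)"
    using vT by (simp add: dim_insert)
  then obtain B where B: "B \<subseteq> T" "finite B" "card B = dim T" "pairwise orthogonal B"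
      "\<forall>v\<in>B. norm v = 1 \<and> (\<exists>c. A *v v = c *\<^sub>R v)"
    using Suc.hyps(1)[OF _ T inv] Suc.hyps(2) by auto
  have "v \<notin> B" using B(1) vT by auto
  then show ?case
    using B v dT
    by (intro exI[of _ "insert v B"])
      (auto simp: pairwise_insert T_def orthogonal_def inner_commute)
qed

lemma symmetric_imp_eigenbasis:
  fixes A :: "real^'n^'n"
  assumes "transpose A = A"
  obtains lam u where "eigenbasis u A lam"
proof -
  obtain B where B: "finite B" "card B = CARD('n)" "pairwise orthogonal B"
      "\<forall>v\<in>B. norm v = 1 \<and> (\<exists>c. A *v v = c *\<^sub>R v)"
    using symmetric_eigenbasis_subspace[OF assms, of UNIV] by auto
  then obtain u where u: "bij_betw u (UNIV :: 'n set) B"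
    using finite_same_card_bij[of "UNIV :: 'n set" B] by auto
  have in_B: "u i \<in> B" for i using u by (auto simp: bij_betw_def)
  obtain lam where "\<And>i. A *v u i = lam i *\<^sub>R u i"
    using B(4) in_B choice[of "\<lambda>i c. A *v u i = c *\<^sub>R u i"] by blast
  moreover have "u i \<bullet> u j = (if i = j then 1 else 0)" for i j
  proof (cases "i = j")
    case True
    then show ?thesis using B(4) in_B[of j] by (auto simp: dot_square_norm)
  next
    case False
    then have "u i \<noteq> u j"
      using u by (auto simp: bij_betw_def inj_on_def)
    then show ?thesis
      using False pairwiseD[OF B(3) in_B[of i] in_B[of j]] by (simp add: orthogonal_def)
  qed
  ultimately have "eigenbasis u A lam"
    by unfold_locales
  then show thesis using that by blast
qed

text \<open>A segment from outside \<open>C\<close> to inside is connected, so it meets the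
  frontier. Thus, for eigenvalues outside \<open>C\<close>, a gap to the frontier becomes a gap to
  all points of \<open>C\<close>.\<close>

lemma frontier_point_between:
  fixes y z :: real
  assumes "y \<in> C" "z \<notin> C"
  obtains p where "p \<in> frontier C" "\<bar>z - p\<bar> \<le> \<bar>z - y\<bar>"
proof -
  have "closed_segment z y \<inter> frontier C \<noteq> {}"
    using assms by (intro connected_Int_frontier) auto
  then obtain p where p: "p \<in> closed_segment z y" "p \<in> frontier C" by blast
  have "\<bar>z - p\<bar> \<le> \<bar>z - y\<bar>"
    using p(1) by (auto simp: closed_segment_eq_real_ivl split: if_splits)
  with p(2) show thesis by (rule that)
qed

section \<open>Comparison of two eigenbases\<close>

lemma minus_matrix_vector_mult: "(- A) *v v = - (A *v v)" for A :: "real^'n^'m"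
  using matrix_vector_mult_diff_rdistrib[of 0 A v] by simp

locale eigenbasis_pair = A: eigenbasis u A lam + B: eigenbasis w B mu
  for u w :: "'n::finite \<Rightarrow> real^'n" and A B lam mu
begin

text \<open>Davis--Kahan: the operator \<open>X = A.pr J \<circ> B.pr F\<close> satisfies the Sylvester equation
  \<open>(A - c) X - X (B - c) = - A.pr J (B - A) (B.pr F)\<close>.\<close>

lemma davis_kahan:
  assumes J: "\<And>i. i \<in> J \<Longrightarrow> R + d \<le> \<bar>lam i - c\<bar>"
    and F: "\<And>j. j \<in> F \<Longrightarrow> \<bar>mu j - c\<bar> \<le> R"
    and R: "0 \<le> R" and d: "0 \<le> d"
    and \<eta>: "\<And>v. norm (A.pr J ((B - A) *v B.pr F v)) \<le> \<eta> * norm v"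
  shows "d * norm (A.pr J (B.pr F v)) \<le> \<eta> * norm v"
proof -
  define X where "X = (\<lambda>v. A.pr J (B.pr F v))"
  have X: "bounded_linear X"
    unfolding X_def using bounded_linear_compose[OF A.bounded_linear_pr B.bounded_linear_pr]
    by (simp add: o_def)
  note le = onorm[OF X] and pos = onorm_pos_le[OF X]
  have step: "(R + d) * norm (X v) \<le> (onorm X * R + \<eta>) * norm v" for v
  proof -
    let ?y = "B.pr F v"
    have "(R + d) * norm (X v) \<le> norm (A.pr J (A *v ?y - c *\<^sub>R ?y))"
      unfolding X_def using J R d by (intro A.norm_shift_ge) auto
    also have "A.pr J (A *v ?y - c *\<^sub>R ?y) = X (B *v v - c *\<^sub>R v) - A.pr J ((B - A) *v ?y)"
      by (simp add: X_def A.pr_diff A.pr_scale B.pr_diff B.pr_scale B.pr_mult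
          matrix_vector_mult_diff_rdistrib)
    also have "norm \<dots> \<le> norm (X (B *v v - c *\<^sub>R v)) + \<eta> * norm v"
      using norm_triangle_ineq4 \<eta>[of v] by (smt (verit))
    also have "X (B *v v - c *\<^sub>R v) = X (B.pr F (B *v v - c *\<^sub>R v))"
      by (simp add: X_def B.pr_pr)
    also have "norm \<dots> \<le> onorm X * norm (B.pr F (B *v v - c *\<^sub>R v))"
      by (rule le)
    also have "norm (B.pr F (B *v v - c *\<^sub>R v)) \<le> R * norm (B.pr F v)"
      using F R by (intro B.norm_shift_le) auto
    also have "\<dots> \<le> R * norm v"
      using R by (intro mult_left_mono B.norm_pr_le)
    finally have "(R + d) * norm (X v) \<le> onorm X * (R * norm v) + \<eta> * norm v"
      using pos by (simp add: mult_left_mono)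
    then show ?thesis by (simp add: algebra_simps)
  qed
  show ?thesis
  proof (cases "R + d = 0")
    case True
    then have "d = 0" using R d by simp
    then show ?thesis using order_trans[OF norm_ge_zero \<eta>[of v]] by simp
  next
    case False
    then have Rd: "0 < R + d" using R d by simp
    have "norm (X v) \<le> (onorm X * R + \<eta>) / (R + d) * norm v" for v
      using step[of v] Rd by (simp add: pos_le_divide_eq mult.commute)
    \<comment> \<open>The estimate holds for all \<open>v\<close>, so it bounds
      \<open>onorm X\<close> in terms of itself; the contribution of \<open>R\<close> then cancels
      and the factor \<open>d\<close> remains.\<close>
    then have "onorm X \<le> (onorm X * R + \<eta>) / (R + d)"
      by (rule onorm_le)
    then have "d * onorm X \<le> \<eta>"
      using Rd by (simp add: pos_le_divide_eq algebra_simps)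
    then show ?thesis
      using mult_right_mono[of "d * onorm X" \<eta> "norm v"] mult_left_mono[OF le[of v] d]
      by (simp add: X_def mult.assoc)
  qed
qed

section \<open>Rank comparison and two-sided projection bounds\<close>

lemma count_ge:
  assumes block: "\<And>v. \<bar>A.pr N v \<bullet> ((B - A) *v A.pr N v)\<bar> \<le> d / 6 * (norm (A.pr N v))\<^sup>2"
    and e: "\<And>v. norm ((B - A) *v v) \<le> e * norm v" "0 \<le> e"
    and lam_d: "\<And>i. lam i < b \<Longrightarrow> lam i \<le> b - d"
    and lam_M: "\<And>i. lam i < b \<Longrightarrow> i \<notin> N \<Longrightarrow> lam i \<le> b - M"
    and d: "0 < d" and M: "2 * e < M" "6 * e\<^sup>2 \<le> M * d"
  shows "card {j. b \<le> mu j} \<le> card {i. b \<le> lam i}"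
\<comment> \<open>Otherwise the eigenvectors of \<open>B\<close> for \<open>mu j \<ge> b\<close> and those of \<open>A\<close> for \<open>lam i < b\<close>
  span subspaces with a common vector \<open>v \<noteq> 0\<close>, whose quadratic forms contradict the gap.\<close>
proof (rule ccontr)
  let ?U = "{j. b \<le> mu j}" and ?L = "{i. lam i < b}"
  let ?S = "span (w ` ?U)" and ?T = "span (u ` ?L)"
  assume "\<not> ?thesis"
  moreover have "card {i. b \<le> lam i} + card ?L = CARD('n)"
    using card_Un_disjoint[of "{i. b \<le> lam i}" ?L]
    by (simp add: Collect_disj_eq[symmetric] not_less[symmetric] disjoint_iff)
  moreover have "dim {x + y |x y. x \<in> ?S \<and> y \<in> ?T} + dim (?S \<inter> ?T) = dim ?S + dim ?T"
    by (rule dim_sums_Int) (auto simp: subspace_span)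
  moreover have "dim {x + y |x y. x \<in> ?S \<and> y \<in> ?T} \<le> CARD('n)"
    using dim_subset_UNIV[of "{x + y |x y. x \<in> ?S \<and> y \<in> ?T}"] by simp
  ultimately have "0 < dim (?S \<inter> ?T)"
    unfolding A.dim_span_image B.dim_span_image by linarith
  then have "\<not> ?S \<inter> ?T \<subseteq> {0}"
    using dim_eq_0[of "?S \<inter> ?T"] by linarith
  then obtain v where v: "v \<in> ?S" "v \<in> ?T" "v \<noteq> 0" by blast
  have split: "sum f UNIV = sum f N + sum f (- N)" for f :: "'n \<Rightarrow> real"
    using sum.union_disjoint[of N "- N" f] by (simp add: Compl_partition)
  define p where "p = norm (A.pr N v)"
  define q where "q = norm (A.pr (- N) v)"
  have norm_v: "(norm v)\<^sup>2 = p\<^sup>2 + q\<^sup>2"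
    using A.norm_square[of v] split[of "\<lambda>i. (u i \<bullet> v)\<^sup>2"]
    by (simp add: p_def q_def A.norm_pr_square)
  have low: "b * (norm v)\<^sup>2 \<le> v \<bullet> (B *v v)"
  proof -
    have "w j \<bullet> v = 0" if "j \<notin> ?U" for j
      using B.inner_pr[of j ?U v] B.pr_span[OF v(1)] that by auto
    then have "b * (w j \<bullet> v)\<^sup>2 \<le> mu j * (w j \<bullet> v)\<^sup>2" for j
      by (cases "j \<in> ?U") (auto intro: mult_right_mono)
    then show ?thesis
      unfolding B.norm_square B.quadratic_form sum_distrib_left by (rule sum_mono)
  qed
  have up: "v \<bullet> (A *v v) \<le> (b - d) * p\<^sup>2 + (b - M) * q\<^sup>2"
  proof -
    have zero: "u i \<bullet> v = 0" if "i \<notin> ?L" for i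
      using A.inner_pr[of i ?L v] A.pr_span[OF v(2)] that by auto
    have 1: "lam i * (u i \<bullet> v)\<^sup>2 \<le> (b - d) * (u i \<bullet> v)\<^sup>2" for i
      using zero[of i] lam_d[of i] by (cases "i \<in> ?L") (auto intro: mult_right_mono)
    have 2: "lam i * (u i \<bullet> v)\<^sup>2 \<le> (b - M) * (u i \<bullet> v)\<^sup>2" if "i \<notin> N" for i
      using zero[of i] lam_M[of i] that by (cases "i \<in> ?L") (auto intro: mult_right_mono)
    show ?thesis
      unfolding p_def q_def A.norm_pr_square A.quadratic_form sum_distrib_left split
      using 1 2 by (intro add_mono sum_mono) auto
  qed
  \<comment> \<open>The block bound serves the near square. Cross terms and the far square get the
    crude bound \<open>e\<close>, which the gap \<open>M\<close> of the far coordinates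
    absorbs.\<close>
  have E: "v \<bullet> ((B - A) *v v) \<le> d / 6 * p\<^sup>2 + 2 * e * p * q + e * q\<^sup>2"
  proof -
    let ?E = "(*v) (B - A)"
    have bound: "y \<bullet> ?E z \<le> e * norm y * norm z" for y z
      using norm_cauchy_schwarz[of y "?E z"] mult_left_mono[OF e(1)[of z] norm_ge_zero[of y]]
      by (simp add: mult_ac)
    have "v \<bullet> ?E v = (A.pr N v + A.pr (- N) v) \<bullet> ?E (A.pr N v + A.pr (- N) v)"
      by (simp add: A.pr_compl)
    also have "\<dots> = A.pr N v \<bullet> ?E (A.pr N v) + A.pr N v \<bullet> ?E (A.pr (- N) v)
        + A.pr (- N) v \<bullet> ?E (A.pr N v) + A.pr (- N) v \<bullet> ?E (A.pr (- N) v)"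
      by (simp only: inner_add_left inner_add_right matrix_vector_right_distrib)
    also have "\<dots> \<le> d / 6 * p\<^sup>2 + e * p * q + e * q * p + e * q * q"
      unfolding p_def q_def using block[of v] by (intro add_mono bound) linarith
    finally show ?thesis by (simp add: power2_eq_square)
  qed
  have "v \<bullet> (B *v v) = v \<bullet> (A *v v) + v \<bullet> ((B - A) *v v)"
    by (simp add: matrix_vector_mult_diff_rdistrib inner_diff_right)
  moreover have "b * (norm v)\<^sup>2 = b * p\<^sup>2 + b * q\<^sup>2"
    unfolding norm_v by (rule distrib_left)
  ultimately have "d * p\<^sup>2 + M * q\<^sup>2 \<le> d / 6 * p\<^sup>2 + 2 * e * p * q + e * q\<^sup>2"
    using low up E unfolding left_diff_distrib by linarith
  \<comment> \<open>Complete the square, using \<open>6 * e\<^sup>2 \<le> M * d\<close>. With the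
    block term \<open>d / 6\<close> this spends half of \<open>d\<close>; the remaining coefficients
    \<open>d / 2\<close> and \<open>M / 2 - e\<close> are positive.\<close>
  moreover have "2 * e * p * q \<le> d / 3 * p\<^sup>2 + M / 2 * q\<^sup>2"
  proof -
    have "0 < M" using M(1) e(2) by simp
    have "0 \<le> (2 * e * p - M * q)\<^sup>2" by simp
    also have "\<dots> = 4 * e\<^sup>2 * p\<^sup>2 - 4 * M * (e * p * q) + M\<^sup>2 * q\<^sup>2"
      by (simp add: power2_eq_square algebra_simps)
    also have "4 * e\<^sup>2 * p\<^sup>2 \<le> 4 * (M * d / 6) * p\<^sup>2"
      using M(2) by (intro mult_right_mono) auto
    finally have "0 \<le> 2 * M * (d / 3 * p\<^sup>2 + M / 2 * q\<^sup>2 - 2 * e * p * q)"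
      by (simp add: power2_eq_square algebra_simps)
    then show ?thesis using \<open>0 < M\<close> by (simp add: zero_le_mult_iff)
  qed
  ultimately have "d / 2 * p\<^sup>2 + (M / 2 - e) * q\<^sup>2 \<le> 0"
    unfolding left_diff_distrib by linarith
  moreover have "0 \<le> d / 2 * p\<^sup>2" "0 \<le> (M / 2 - e) * q\<^sup>2"
    using d M(1) by auto
  ultimately have "d / 2 * p\<^sup>2 = 0" "(M / 2 - e) * q\<^sup>2 = 0"
    by linarith+
  then have "(norm v)\<^sup>2 = 0"
    using d M(1) norm_v by auto
  then show False using v(3) by simp
qed

text \<open>The rank inequality turns a one-sided bound into a two-sided one. If
  \<open>s < 1\<close>, then \<open>A.pr J\<close> is injective on the range of
  \<open>B.pr F\<close>, so by dimension its image is the whole range of \<open>A.pr J\<close>: each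
  \<open>A.pr J x\<close> equals \<open>A.pr J y\<close> for some \<open>y\<close> in the range of
  \<open>B.pr F\<close>.\<close>

lemma pr_difference_le:
  assumes card: "card J \<le> card F"
    and s: "\<And>v. norm (A.pr (- J) (B.pr F v)) \<le> s * norm v"
  shows "norm (B.pr F x - A.pr J x) \<le> 2 * s * norm x"
proof (cases "1 \<le> s")
  case True
  have "norm (B.pr F x - A.pr J x) \<le> norm x + norm x"
    using norm_triangle_ineq4[of "B.pr F x" "A.pr J x"] A.norm_pr_le[of J x] B.norm_pr_le[of F x]
    by linarith
  also have "\<dots> \<le> 2 * s * norm x"
    using mult_right_mono[OF True norm_ge_zero[of x]] by simp
  finally show ?thesis .
next
  case False
  let ?S = "span (w ` F)" and ?T = "span (u ` J)"
  have close: "norm (y - A.pr J y) \<le> s * norm y" if "y \<in> ?S" for y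
  proof -
    have "y - A.pr J y = A.pr (- J) y"
      using A.pr_compl[of J y] by (simp add: algebra_simps)
    then show ?thesis using s[of y] B.pr_span[OF that] by simp
  qed
  have "inj_on (A.pr J) ?S"
  proof (rule linear_inj_on_iff_eq_0[OF A.linear_pr subspace_span, THEN iffD2], intro ballI impI)
    fix y assume "y \<in> ?S" "A.pr J y = 0"
    with close have "norm y \<le> s * norm y" by fastforce
    then show "y = 0"
      using False by (metis linorder_not_le mult_le_cancel_right1 norm_le_zero_iff)
  qed
  then have "dim (A.pr J ` ?S) = dim ?S"
    by (intro dim_image_eq A.linear_pr) (simp add: span_span)
  then have "A.pr J ` ?S = ?T"
    using card A.pr_in_span
    by (intro subspace_dim_equal linear_subspace_image[OF A.linear_pr] subspace_span)
      (auto simp: A.dim_span_image[unfolded dim_span] B.dim_span_image[unfolded dim_span])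
  then obtain y where y: "y \<in> ?S" "A.pr J y = A.pr J x"
    using A.pr_in_span[of J x] by (metis imageE)
  define z where "z = A.pr J x"
  have left: "norm (B.pr (- F) z) \<le> s * norm z"
  proof (cases "z = 0")
    case True
    then show ?thesis by (simp add: B.pr_def)
  next
    case False
    then have y0: "0 < y \<bullet> y" using y(2) by (auto simp: z_def A.pr_def)
    have zy: "z \<bullet> y = z \<bullet> z"
      unfolding z_def A.pr_inner_commute y(2) A.pr_pr by simp
    have pythagoras: "(y - z) \<bullet> (y - z) = y \<bullet> y - z \<bullet> z"
      using zy by (simp add: inner_diff_left inner_diff_right inner_commute)
    have "(norm (y - z))\<^sup>2 \<le> (s * norm y)\<^sup>2"
      using close[OF y(1)] y(2) by (intro power_mono) (auto simp: z_def)
    then have gap: "y \<bullet> y - z \<bullet> z \<le> s\<^sup>2 * (y \<bullet> y)"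
      using pythagoras by (simp add: power_mult_distrib dot_square_norm)
    have "0 \<le> s * norm y" using close[OF y(1)] by (meson norm_ge_zero order_trans)
    then have s0: "0 \<le> s" using y0 by (auto simp: zero_le_mult_iff)
    \<comment> \<open>As \<open>z \<bullet> y = z \<bullet> z\<close>, the vector
      \<open>c *\<^sub>R y\<close> is the projection of \<open>z\<close> onto the line of
      \<open>y\<close>; it may be subtracted because \<open>B.pr (- F)\<close> kills
      \<open>y\<close>. What is left is \<open>norm z\<close> times the sine of the angle between
      \<open>y\<close> and \<open>z\<close>, and \<open>gap\<close> bounds the squared sine by
      \<open>s\<^sup>2\<close>.\<close>
    define c where "c = z \<bullet> z / (y \<bullet> y)"
    have "B.pr (- F) y = 0"
      using B.pr_pr[of "- F" F y] B.pr_span[OF y(1)] by (simp add: B.pr_def)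
    then have "B.pr (- F) z = B.pr (- F) (z - c *\<^sub>R y)"
      by (simp add: B.pr_diff B.pr_scale)
    then have "(norm (B.pr (- F) z))\<^sup>2 \<le> (norm (z - c *\<^sub>R y))\<^sup>2"
      by (simp add: B.norm_pr_le power_mono)
    also have "\<dots> = z \<bullet> z - 2 * c * (z \<bullet> z) + c * (c * (y \<bullet> y))"
      using zy by (simp add: power2_norm_eq_inner inner_diff_left inner_diff_right inner_commute)
    also have "c * (y \<bullet> y) = z \<bullet> z" using y0 by (simp add: c_def)
    also have "z \<bullet> z - 2 * c * (z \<bullet> z) + c * (z \<bullet> z) = z \<bullet> z * ((y \<bullet> y - z \<bullet> z) / (y \<bullet> y))"
      using y0 by (simp add: c_def field_simps)
    also have "\<dots> \<le> z \<bullet> z * s\<^sup>2"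
      using gap y0 by (intro mult_left_mono) (auto simp: divide_le_eq)
    also have "\<dots> = (s * norm z)\<^sup>2"
      by (simp add: power_mult_distrib dot_square_norm mult.commute)
    finally show ?thesis using s0 by (auto intro: power2_le_imp_le)
  qed
  \<comment> \<open>This operator is the adjoint of the one bounded in \<open>s\<close>, so it
    inherits the bound; pairing \<open>?y\<close> with itself shows it.\<close>
  have right: "norm (B.pr F (A.pr (- J) x)) \<le> s * norm x"
  proof -
    let ?y = "B.pr F (A.pr (- J) x)"
    have "norm ?y * norm ?y = ?y \<bullet> ?y"
      by (simp add: dot_square_norm power2_eq_square)
    also have "\<dots> = x \<bullet> A.pr (- J) (B.pr F ?y)"
      by (simp add: A.pr_inner_commute[symmetric] B.pr_inner_commute[symmetric]
          B.pr_pr)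
    also have "\<dots> \<le> norm x * (s * norm ?y)"
      using norm_cauchy_schwarz[of x] mult_left_mono[OF s[of ?y] norm_ge_zero[of x]]
      by (meson order_trans)
    finally have *: "norm ?y * norm ?y \<le> (s * norm x) * norm ?y" by (simp add: mult_ac)
    have "0 \<le> s * norm x" using s[of x] by (meson norm_ge_zero order_trans)
    with * show ?thesis
      by (cases "norm ?y = 0") (auto simp: mult_le_cancel_right)
  qed
  \<comment> \<open>Q - P = Q (1 - P) - (1 - Q) P for P = \<open>A.pr J\<close> and Q =
    \<open>B.pr F\<close>.\<close>
  have "B.pr F x - A.pr J x = B.pr F (A.pr (- J) x) - B.pr (- F) z"
    using A.pr_compl[of J x] B.pr_compl[of F z] B.pr_add[of F z "A.pr (- J) x"]
    by (simp add: z_def algebra_simps)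
  also have "norm \<dots> \<le> s * norm x + s * norm z"
    using norm_triangle_ineq4[of "B.pr F (A.pr (- J) x)" "B.pr (- F) z"] left right by linarith
  also have "s * norm z \<le> s * norm x"
  proof (cases "x = 0")
    case False
    have "0 \<le> s * norm x" using s[of x] by (meson norm_ge_zero order_trans)
    then have "0 \<le> s" using False by (simp add: zero_le_mult_iff)
    then show ?thesis unfolding z_def by (intro mult_left_mono A.norm_pr_le)
  qed (simp add: z_def A.pr_def)
  finally show ?thesis by simp
qed

text \<open>The mirror image of \<open>count_ge\<close>: negating both matrices reverses the order
  of the eigenvalues and keeps eigenvectors and norm bounds.\<close>

lemma count_le:
  assumes block: "\<And>v. \<bar>A.pr N v \<bullet> ((B - A) *v A.pr N v)\<bar> \<le> d / 6 * (norm (A.pr N v))\<^sup>2"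
    and e: "\<And>v. norm ((B - A) *v v) \<le> e * norm v" "0 \<le> e"
    and lam_d: "\<And>i. b < lam i \<Longrightarrow> b + d \<le> lam i"
    and lam_M: "\<And>i. b < lam i \<Longrightarrow> i \<notin> N \<Longrightarrow> b + M \<le> lam i"
    and d: "0 < d" and M: "2 * e < M" "6 * e\<^sup>2 \<le> M * d"
  shows "card {j. mu j \<le> b} \<le> card {i. lam i \<le> b}"
proof -
  interpret neg: eigenbasis_pair u w "- A" "- B" "\<lambda>i. - lam i" "\<lambda>j. - mu j"
    by unfold_locales (simp_all add: A.eigen B.eigen minus_matrix_vector_mult)
  have flip: "(- B - - A) *v v = - ((B - A) *v v)" for v
    by (simp add: matrix_vector_mult_diff_rdistrib minus_matrix_vector_mult)
  have "card {j. - b \<le> - mu j} \<le> card {i. - b \<le> - lam i}"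
  proof (rule neg.count_ge[where N = N and d = d and e = e and M = M])
    fix v
    show "\<bar>A.pr N v \<bullet> ((- B - - A) *v A.pr N v)\<bar> \<le> d / 6 * (norm (A.pr N v))\<^sup>2"
      unfolding flip inner_minus_right abs_minus_cancel by (rule block)
    show "norm ((- B - - A) *v v) \<le> e * norm v"
      unfolding flip norm_minus_cancel by (rule e(1))
  next
    fix i assume i: "- lam i < - b"
    show "- lam i \<le> - b - d" using lam_d[of i] i by simp
    show "i \<notin> N \<Longrightarrow> - lam i \<le> - b - M" using lam_M[of i] i by simp
  qed (fact e(2) d M)+
  then show ?thesis by simp
qed

text \<open>Eigenvalues outside the interval lie above or below it, and on neither side does
  \<open>B\<close> have more than \<open>A\<close>. Both totals are \<open>CARD('n)\<close>, so
  \<open>B\<close> has at least as many inside.\<close>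

lemma count_interval:
  assumes block: "\<And>v. \<bar>A.pr N v \<bullet> ((B - A) *v A.pr N v)\<bar> \<le> d / 6 * (norm (A.pr N v))\<^sup>2"
    and e: "\<And>v. norm ((B - A) *v v) \<le> e * norm v" "0 \<le> e"
    and C: "open C" "is_interval C" "C \<noteq> {}"
    and gap_d: "\<And>i p. p \<in> frontier C \<Longrightarrow> d \<le> \<bar>lam i - p\<bar>"
    and gap_M: "\<And>i p. p \<in> frontier C \<Longrightarrow> i \<notin> N \<Longrightarrow> M \<le> \<bar>lam i - p\<bar>"
    and d: "0 < d" and M: "2 * e < M" "6 * e\<^sup>2 \<le> M * d"
  shows "card {i. lam i \<in> C} \<le> card {j. mu j \<in> C}"
proof -
  have above: "card {j. \<forall>y\<in>C. y < mu j} \<le> card {i. \<forall>y\<in>C. y < lam i}"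
  proof (cases "bdd_above C")
    case True
    have "Sup C \<in> closure C" using True C(3) by (intro closure_contains_Sup)
    moreover have "Sup C \<notin> C"
    proof -
      obtain x where "\<forall>y\<in>C. y \<le> x" using True by (auto simp: bdd_above_def)
      then have "\<forall>y\<in>C. y < x + 1" by fastforce
      then show ?thesis by (rule Sup_notin_open[OF C(1)])
    qed
    ultimately have b: "Sup C \<in> frontier C"
      using C(1) by (simp add: frontier_def interior_open)
    \<comment> \<open>The open set \<open>C\<close> omits its endpoint, so equality with
      \<open>Sup C\<close> counts as lying above \<open>C\<close>. This matches the non-strict count
      in \<open>count_ge\<close>.\<close>
    have iff: "(\<forall>y\<in>C. y < z) \<longleftrightarrow> Sup C \<le> z" for z
    proof
      show "Sup C \<le> z" if "\<forall>y\<in>C. y < z"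
        using that C(3) by (intro cSup_least) auto
      show "\<forall>y\<in>C. y < z" if "Sup C \<le> z"
      proof
        fix y assume "y \<in> C"
        then have "y \<le> Sup C" "y \<noteq> Sup C"
          using cSup_upper[OF _ True] \<open>Sup C \<notin> C\<close> by auto
        then show "y < z" using that by linarith
      qed
    qed
    show ?thesis unfolding iff
    proof (rule count_ge[OF block e])
      fix i assume i: "lam i < Sup C"
      show "lam i \<le> Sup C - d" using gap_d[OF b, of i] i by linarith
      show "i \<notin> N \<Longrightarrow> lam i \<le> Sup C - M" using gap_M[OF b, of i] i by linarith
    qed (fact d M)+
  next
    case False
    then have "\<not> (\<forall>y\<in>C. y < z)" for z
      unfolding bdd_above_def by (meson less_imp_le)
    then have empty: "{j. \<forall>y\<in>C. y < mu j} = {}" by blast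
    show ?thesis unfolding empty by simp
  qed
  have below: "card {j. \<forall>y\<in>C. mu j < y} \<le> card {i. \<forall>y\<in>C. lam i < y}"
  proof (cases "bdd_below C")
    case True
    have "Inf C \<in> closure C" using True C(3) by (intro closure_contains_Inf)
    moreover have "Inf C \<notin> C"
    proof -
      obtain x where "\<forall>y\<in>C. x \<le> y" using True by (auto simp: bdd_below_def)
      then have "\<forall>y\<in>C. x - 1 < y" by fastforce
      then show ?thesis by (rule Inf_notin_open[OF C(1)])
    qed
    ultimately have b: "Inf C \<in> frontier C"
      using C(1) by (simp add: frontier_def interior_open)
    have iff: "(\<forall>y\<in>C. z < y) \<longleftrightarrow> z \<le> Inf C" for z
    proof
      show "z \<le> Inf C" if "\<forall>y\<in>C. z < y"
        using that C(3) by (intro cInf_greatest) auto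
      show "\<forall>y\<in>C. z < y" if "z \<le> Inf C"
      proof
        fix y assume "y \<in> C"
        then have "Inf C \<le> y" "y \<noteq> Inf C"
          using cInf_lower[OF _ True] \<open>Inf C \<notin> C\<close> by auto
        then show "z < y" using that by linarith
      qed
    qed
    show ?thesis unfolding iff
    proof (rule count_le[OF block e])
      fix i assume i: "Inf C < lam i"
      show "Inf C + d \<le> lam i" using gap_d[OF b, of i] i by linarith
      show "i \<notin> N \<Longrightarrow> Inf C + M \<le> lam i" using gap_M[OF b, of i] i by linarith
    qed (fact d M)+
  next
    case False
    then have "\<not> (\<forall>y\<in>C. z < y)" for z
      unfolding bdd_below_def by (meson less_imp_le)
    then have empty: "{j. \<forall>y\<in>C. mu j < y} = {}" by blast
    show ?thesis unfolding empty by simp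
  qed
  have compl: "z \<notin> C \<longleftrightarrow> (\<forall>y\<in>C. y < z) \<or> (\<forall>y\<in>C. z < y)" for z
  proof
    assume z: "z \<notin> C"
    show "(\<forall>y\<in>C. y < z) \<or> (\<forall>y\<in>C. z < y)"
    proof (rule ccontr)
      assume "\<not> ?thesis"
      then obtain x y where "x \<in> C" "y \<in> C" "z \<le> x" "y \<le> z"
        by (auto simp: not_less)
      then show False using C(2) z unfolding is_interval_1 by blast
    qed
  qed auto
  have count: "CARD('n) = card {i. f i \<in> C} + card {i. \<forall>y\<in>C. y < f i} + card {i. \<forall>y\<in>C. f i < y}"
    for f :: "'n \<Rightarrow> real"
  proof -
    obtain c where c: "c \<in> C" using C(3) by blast
    have "(UNIV :: 'n set) = {i. f i \<in> C} \<union> ({i. \<forall>y\<in>C. y < f i} \<union> {i. \<forall>y\<in>C. f i < y})"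
      using compl by blast
    moreover have "card \<dots> = card {i. f i \<in> C} + card ({i. \<forall>y\<in>C. y < f i} \<union> {i. \<forall>y\<in>C. f i < y})"
      using compl by (intro card_Un_disjoint) auto
    moreover have "card ({i. \<forall>y\<in>C. y < f i} \<union> {i. \<forall>y\<in>C. f i < y})
        = card {i. \<forall>y\<in>C. y < f i} + card {i. \<forall>y\<in>C. f i < y}"
      using c by (intro card_Un_disjoint) (auto dest: order.asym)
    ultimately show ?thesis by simp
  qed
  show ?thesis using count[of lam] count[of mu] above below by linarith
qed

text \<open>Center and radius for \<open>davis_kahan\<close> come from the hull of the
  \<open>mu j\<close> in \<open>C\<close>, so \<open>C\<close> may be unbounded. For
  \<open>i \<in> J\<close>, \<open>lam i\<close> lies beyond one end of this hull, at distance at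
  least \<open>d\<close>.\<close>

lemma davis_kahan_interval:
  assumes C: "is_interval C"
    and J: "\<And>i. i \<in> J \<Longrightarrow> lam i \<notin> C" "\<And>i y. i \<in> J \<Longrightarrow> y \<in> C \<Longrightarrow> d \<le> \<bar>lam i - y\<bar>"
    and d: "0 \<le> d"
    and \<eta>: "\<And>v. norm (A.pr J ((B - A) *v B.pr {j. mu j \<in> C} v)) \<le> \<eta> * norm v"
  shows "d * norm (A.pr J (B.pr {j. mu j \<in> C} v)) \<le> \<eta> * norm v"
proof (cases "{j. mu j \<in> C} = {}")
  case True
  have "0 \<le> \<eta> * norm v" using \<eta>[of v] norm_ge_zero order_trans by blast
  then show ?thesis unfolding True by (simp add: A.pr_def B.pr_def)
next
  case False
  let ?M = "mu ` {j. mu j \<in> C}"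
  define l where "l = Min ?M"
  define r where "r = Max ?M"
  have "l \<in> ?M" "r \<in> ?M" using False by (auto simp: l_def r_def intro!: Min_in Max_in)
  then have lr: "l \<in> C" "r \<in> C" by auto
  have between: "l \<le> mu j" "mu j \<le> r" if "mu j \<in> C" for j
    using that by (auto simp: l_def r_def)
  have "l \<le> r" using \<open>l \<in> ?M\<close> between by auto
  show ?thesis
  proof (rule davis_kahan[where c = "(l + r) / 2" and R = "(r - l) / 2"])
    fix i assume i: "i \<in> J"
    have "lam i < l \<or> r < lam i"
      using J(1)[OF i] lr C unfolding is_interval_1 by (meson not_less)
    then show "(r - l) / 2 + d \<le> \<bar>lam i - (l + r) / 2\<bar>"
      using J(2)[OF i lr(1)] J(2)[OF i lr(2)] \<open>l \<le> r\<close> by (auto simp: abs_if field_simps split: if_splits)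
  next
    fix j assume "j \<in> {j. mu j \<in> C}"
    then show "\<bar>mu j - (l + r) / 2\<bar> \<le> (r - l) / 2"
      using between[of j] by (auto simp: abs_if field_simps)
  qed (use \<open>l \<le> r\<close> d \<eta> in auto)
qed

text \<open>The estimate for one component: \<open>e\<close> stands for the norm of the
  perturbation, \<open>g\<close> for r_K x and \<open>N\<close> for the near indices. Far indices
  are \<open>K * e\<close> away from \<open>C\<close>, near ones outside \<open>C\<close> are only
  known to be \<open>d\<close> away, so the two groups are treated separately.\<close>

lemma spectral_proj_interval_difference:
  assumes C: "open C" "is_interval C" "C \<noteq> {}"
    and N: "{i. lam i \<in> C} \<subseteq> N"
    and gap: "\<And>i p. p \<in> frontier C \<Longrightarrow> d \<le> \<bar>lam i - p\<bar>"
    and far: "\<And>i y. i \<notin> N \<Longrightarrow> y \<in> C \<Longrightarrow> K * e \<le> \<bar>lam i - y\<bar>"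
    and e: "\<And>v. norm ((B - A) *v v) \<le> e * norm v" "0 < e"
    and block: "\<And>v w. \<bar>A.pr N v \<bullet> ((B - A) *v A.pr N w)\<bar> \<le> g * norm (A.pr N v) * norm (A.pr N w)"
    and "0 \<le> g" "0 < K" "0 < d" and d: "6 * e \<le> K * d" "36 * g * e \<le> d\<^sup>2"
  shows "norm ((spectral_proj B C - spectral_proj A C) *v v)
    \<le> 2 * (1 / K + (g + e / K) / d) * norm v"
proof -
  let ?J = "{i. lam i \<in> C}" and ?F = "{j. mu j \<in> C}"
  \<comment> \<open>Far indices satisfy both gap bounds, hence the maximum. It exceeds
    \<open>2 * e\<close> even for small \<open>K\<close>: otherwise also
    \<open>d \<le> 2 * e\<close>, so \<open>M * d \<le> 4 * e\<^sup>2\<close>, against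
    \<open>6 * e\<^sup>2 \<le> M * d\<close>.\<close>
  define M where "M = max (K * e) d"
  have M6: "6 * e\<^sup>2 \<le> M * d"
  proof -
    have "6 * e\<^sup>2 \<le> (K * e) * d"
      using mult_left_mono[OF d(1), of e] e(2) by (simp add: power2_eq_square mult_ac)
    also have "\<dots> \<le> M * d" using \<open>0 < d\<close> by (intro mult_right_mono) (auto simp: M_def)
    finally show ?thesis .
  qed
  have M2: "2 * e < M"
  proof (rule ccontr)
    assume "\<not> ?thesis"
    then have M: "M \<le> 2 * e" "d \<le> 2 * e" "0 \<le> M" using \<open>0 < d\<close> by (auto simp: M_def)
    then have "M * d \<le> (2 * e) * (2 * e)" using \<open>0 < d\<close> by (intro mult_mono) auto
    moreover have "0 < e * e" using e(2) by simp
    ultimately show False using M6 by (simp add: power2_eq_square)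
  qed
  have card: "card ?J \<le> card ?F"
  proof (rule count_interval[OF _ e(1) less_imp_le[OF e(2)] C gap _ \<open>0 < d\<close> M2 M6])
    fix v
    let ?y = "A.pr N v"
    have "\<bar>?y \<bullet> ((B - A) *v ?y)\<bar> \<le> g * (norm ?y)\<^sup>2"
      using block[of v v] by (simp add: power2_eq_square mult.assoc)
    moreover have "\<bar>?y \<bullet> ((B - A) *v ?y)\<bar> \<le> e * (norm ?y)\<^sup>2"
      using Cauchy_Schwarz_ineq2[of ?y "(B - A) *v ?y"] mult_left_mono[OF e(1)[of ?y] norm_ge_zero[of ?y]]
      by (simp add: power2_eq_square mult_ac)
    \<comment> \<open>Both \<open>g\<close> and \<open>e\<close> bound the form, and their product
      is at most the square of \<open>d / 6\<close>, so the smaller one is at most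
      \<open>d / 6\<close>.\<close>
    moreover have "g \<le> d / 6 \<or> e \<le> d / 6"
    proof (rule ccontr)
      assume "\<not> ?thesis"
      then have "d / 6 * (d / 6) < g * e" using \<open>0 < d\<close> by (intro mult_strict_mono) auto
      then show False using d(2) by (simp add: power2_eq_square)
    qed
    ultimately show "\<bar>?y \<bullet> ((B - A) *v ?y)\<bar> \<le> d / 6 * (norm ?y)\<^sup>2"
      using mult_right_mono[of g "d / 6" "(norm ?y)\<^sup>2"] mult_right_mono[of e "d / 6" "(norm ?y)\<^sup>2"]
      by force
  next
    fix i p assume p: "p \<in> frontier C" and i: "i \<notin> N"
    \<comment> \<open>Frontier points of the open set \<open>C\<close> lie outside it, so the far
      bound must pass to the closure.\<close>
    have "C \<subseteq> {y. K * e \<le> \<bar>lam i - y\<bar>}" using far[OF i] by blast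
    moreover have "closed {y. K * e \<le> \<bar>lam i - y\<bar>}"
      by (intro closed_Collect_le continuous_intros)
    ultimately have "closure C \<subseteq> {y. K * e \<le> \<bar>lam i - y\<bar>}" by (rule closure_minimal)
    then have "K * e \<le> \<bar>lam i - p\<bar>" using p by (auto simp: frontier_def)
    then show "M \<le> \<bar>lam i - p\<bar>" using gap[OF p, of i] by (simp add: M_def)
  qed
  \<comment> \<open>A gap \<open>K * e\<close> against a perturbation of norm at most
    \<open>e\<close> gives the quotient \<open>1 / K\<close>.\<close>
  have far_part: "norm (A.pr (- N) (B.pr ?F v)) \<le> 1 / K * norm v" for v
  proof -
    have "(K * e) * norm (A.pr (- N) (B.pr ?F v)) \<le> e * norm v"
    proof (rule davis_kahan_interval[OF C(2)])
      fix v
      have "norm (A.pr (- N) ((B - A) *v B.pr ?F v)) \<le> e * norm (B.pr ?F v)"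
        using A.norm_pr_le e(1) by (rule order_trans)
      also have "\<dots> \<le> e * norm v"
        using e(2) by (intro mult_left_mono B.norm_pr_le) auto
      finally show "norm (A.pr (- N) ((B - A) *v B.pr ?F v)) \<le> e * norm v" .
    qed (use N far e(2) \<open>0 < K\<close> in auto)
    then show ?thesis using e(2) \<open>0 < K\<close> by (simp add: field_simps)
  qed
  \<comment> \<open>Within the near coordinates the perturbation has norm at most \<open>g\<close>.
    The far coordinates of \<open>B.pr ?F v\<close> are already small by \<open>far_part\<close>,
    whence the extra term \<open>e / K\<close>.\<close>
  have near_part: "norm (A.pr (N - ?J) (B.pr ?F v)) \<le> (g + e / K) / d * norm v" for v
  proof -
    have "d * norm (A.pr (N - ?J) (B.pr ?F v)) \<le> (g + e / K) * norm v"
    proof (rule davis_kahan_interval[OF C(2)])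
      fix i y assume "i \<in> N - ?J" "y \<in> C"
      then obtain p where "p \<in> frontier C" "\<bar>lam i - p\<bar> \<le> \<bar>lam i - y\<bar>"
        using frontier_point_between[of y C "lam i"] by blast
      then show "d \<le> \<bar>lam i - y\<bar>" using gap[of p i] by linarith
    next
      fix v
      define y where "y = B.pr ?F v"
      have y: "norm y \<le> norm v" unfolding y_def by (rule B.norm_pr_le)
      let ?z = "(B - A) *v A.pr N y"
      \<comment> \<open>Testing the bilinear bound at \<open>?z\<close> itself turns it into a norm
        bound.\<close>
      have "norm (A.pr N ?z) * norm (A.pr N ?z) = A.pr N ?z \<bullet> ?z"
        by (simp add: A.norm_pr_square power2_eq_square[symmetric])
           (simp add: A.pr_def inner_sum_left power2_eq_square)
      also have "\<dots> \<le> (g * norm (A.pr N y)) * norm (A.pr N ?z)"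
        using block[of ?z y] by (simp add: mult_ac)
      finally have "norm (A.pr N ?z) \<le> g * norm (A.pr N y)"
        using \<open>0 \<le> g\<close> by (cases "norm (A.pr N ?z) = 0") (auto simp: mult_le_cancel_right)
      also have "\<dots> \<le> g * norm v"
        using \<open>0 \<le> g\<close> A.norm_pr_le[of N y] y by (intro mult_left_mono) auto
      finally have z: "norm (A.pr (N - ?J) ?z) \<le> g * norm v"
        using A.norm_pr_mono[of "N - ?J" N ?z] by auto
      have "norm (A.pr (N - ?J) ((B - A) *v A.pr (- N) y)) \<le> e * norm (A.pr (- N) y)"
        using A.norm_pr_le e(1) by (rule order_trans)
      also have "\<dots> \<le> e * (1 / K * norm v)"
        unfolding y_def using e(2) far_part by (intro mult_left_mono) auto
      finally have "norm (A.pr (N - ?J) ((B - A) *v A.pr (- N) y)) \<le> e / K * norm v" by simp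
      moreover have split: "A.pr (N - ?J) ((B - A) *v y)
          = A.pr (N - ?J) ?z + A.pr (N - ?J) ((B - A) *v A.pr (- N) y)"
        using A.pr_compl[of N y] by (metis A.pr_add matrix_vector_right_distrib)
      ultimately show "norm (A.pr (N - ?J) ((B - A) *v B.pr ?F v)) \<le> (g + e / K) * norm v"
        unfolding y_def[symmetric] distrib_right split
        using z norm_triangle_ineq[of "A.pr (N - ?J) ?z" "A.pr (N - ?J) ((B - A) *v A.pr (- N) y)"]
        by linarith
    qed (use \<open>0 < d\<close> in auto)
    then show ?thesis using \<open>0 < d\<close> by (simp add: field_simps)
  qed
  have "norm (A.pr (- ?J) (B.pr ?F v)) \<le> (1 / K + (g + e / K) / d) * norm v" for v
  proof -
    have "- ?J = - N \<union> (N - ?J)" using N by blast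
    then have split: "A.pr (- ?J) (B.pr ?F v) = A.pr (- N) (B.pr ?F v) + A.pr (N - ?J) (B.pr ?F v)"
      using A.pr_union[of "- N" "N - ?J" "B.pr ?F v"] by auto
    show ?thesis
      unfolding distrib_right split
      using far_part[of v] near_part[of v]
        norm_triangle_ineq[of "A.pr (- N) (B.pr ?F v)" "A.pr (N - ?J) (B.pr ?F v)"]
      by linarith
  qed
  from pr_difference_le[OF card this, of v] show ?thesis
    by (simp only: matrix_vector_mult_diff_rdistrib A.spectral_proj_mult B.spectral_proj_mult)
qed

end

section \<open>Regions\<close>

text \<open>The inclusion of frontiers lets the gap of \<open>D\<close> serve every
  component.\<close>

lemma region_components:
  assumes "is_region D"
  shows "finite (components D)" and "open D"
    and "C \<in> components D \<Longrightarrow> open C \<and> is_interval C \<and> C \<noteq> {} \<and> C \<subseteq> D \<and> frontier C \<subseteq> frontier D"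
proof -
  obtain \<I> where \<I>: "finite \<I>" "\<forall>I\<in>\<I>. open I \<and> is_interval I" "D = \<Union>\<I>"
    using assms by (auto simp: is_region_def)
  show D: "open D" using \<I> by auto
  \<comment> \<open>Each component contains some interval of the family and is the component of any
    point in it. For an empty interval \<open>SOME\<close> is arbitrary, which at most enlarges the
    covering image.\<close>
  have "components D \<subseteq> (\<lambda>I. connected_component_set D (SOME y. y \<in> I)) ` \<I>"
  proof
    fix C assume "C \<in> components D"
    then obtain y where y: "y \<in> D" "C = connected_component_set D y"
      by (auto simp: components_def)
    then obtain I where I: "I \<in> \<I>" "y \<in> I" using \<I>(3) by auto
    define z where "z = (SOME y. y \<in> I)"
    have z: "z \<in> I" unfolding z_def using I(2) by (rule someI)
    have "connected I" using \<I>(2) I(1) by (simp add: is_interval_connected)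
    moreover have "I \<subseteq> D" using \<I>(3) I(1) by auto
    ultimately have "connected_component D y z"
      using I(2) z by (auto simp: connected_component_def)
    then have "C = connected_component_set D z"
      using y(2) connected_component_eq[of z D y] by auto
    then show "C \<in> (\<lambda>I. connected_component_set D (SOME y. y \<in> I)) ` \<I>"
      using I(1) by (auto simp: z_def)
  qed
  then show "finite (components D)"
    using \<I>(1) finite_surj by blast
  show "open C \<and> is_interval C \<and> C \<noteq> {} \<and> C \<subseteq> D \<and> frontier C \<subseteq> frontier D"
    if "C \<in> components D"
    using that D in_components_connected[OF that] in_components_nonempty[OF that]
      in_components_subset[OF that] open_components[OF D that] frontier_of_components_subset[OF that]
    by (simp add: is_interval_connected_1)
qed

lemma set_edist_le: "s \<in> S \<Longrightarrow> set_edist t S \<le> ereal \<bar>t - s\<bar>"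
  unfolding set_edist_def by (rule INF_lower2[of s]) (auto simp: dist_real_def)

lemma boundary_gap_le: "p \<in> frontier D \<Longrightarrow> boundary_gap lam D \<le> ereal \<bar>lam i - p\<bar>"
  unfolding boundary_gap_def
  by (rule order_trans[OF Min_le set_edist_le]) auto

lemma abs_le_dir_pert: "\<bar>u i \<bullet> (E *v u j)\<bar> \<le> dir_pert u E"
proof -
  have "{\<bar>u i \<bullet> (E *v u j)\<bar> |i j. True} = range (\<lambda>(i, j). \<bar>u i \<bullet> (E *v u j)\<bar>)"
    by auto
  then show ?thesis
    unfolding dir_pert_def by (intro Max_ge) auto
qed

lemma norm_mult_le_spectral_norm: "norm (M *v v) \<le> spectral_norm M * norm v"
  unfolding spectral_norm_def by (intro onorm matrix_vector_mul_bounded_linear)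

lemma spectral_norm_nonneg: "0 \<le> spectral_norm M"
  unfolding spectral_norm_def by (intro onorm_pos_le matrix_vector_mul_bounded_linear)

lemma spectral_norm_pos: "M \<noteq> 0 \<Longrightarrow> 0 < spectral_norm M"
  unfolding spectral_norm_def
  by (subst onorm_pos_lt[OF matrix_vector_mul_bounded_linear]) (auto simp: matrix_eq)

text \<open>Nearness is measured to all of \<open>D\<close>. An index far from \<open>D\<close> is
  far from each component, so one set \<open>N\<close> and one \<open>g\<close> work for all of
  them; the triangle inequality over the components gives the factor
  \<open>num_components D\<close>.\<close>

lemma spectral_proj_region_difference:
  fixes A E :: "real^'n^'n" and K d :: real
  assumes sym: "transpose A = A" "transpose E = E" and basis: "orthonormal_eigenbasis A lam u"
    and D: "is_region D" and "0 < K" "0 < d" "E \<noteq> 0"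
  defines "e \<equiv> spectral_norm E"
    and "g \<equiv> real (near_count lam D (K * spectral_norm E)) * dir_pert u E"
  assumes gap: "\<And>i p. p \<in> frontier D \<Longrightarrow> d \<le> \<bar>lam i - p\<bar>"
    and d: "6 * e \<le> K * d" "36 * g * e \<le> d\<^sup>2"
  shows "spectral_norm (spectral_proj (A + E) D - spectral_proj A D)
    \<le> real (num_components D) * (2 * (1 / K + (g + e / K) / d))"
proof -
  have "transpose (A + E) = A + E"
    using sym by (simp add: transpose_def vec_eq_iff)
  then obtain mu w where w: "eigenbasis w (A + E) mu"
    by (rule symmetric_imp_eigenbasis)
  have u: "eigenbasis u A lam"
    using basis by (simp add: orthonormal_eigenbasis_iff)
  interpret eigenbasis_pair u w A "A + E" lam mu
    using u w by (rule eigenbasis_pair.intro)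
  define N where "N = {i. set_edist (lam i) D \<le> ereal (K * e)}"
  have e: "0 < e" unfolding e_def using \<open>E \<noteq> 0\<close> by (rule spectral_norm_pos)
  have g_eq: "g = real (card N) * dir_pert u E"
    by (simp add: g_def near_count_def N_def e_def)
  have "0 \<le> dir_pert u E"
    using abs_le_dir_pert[of u undefined E undefined] by linarith
  then have g: "0 \<le> g" by (simp add: g_eq)
  let ?s = "2 * (1 / K + (g + e / K) / d)"
  have comp: "norm ((spectral_proj (A + E) C - spectral_proj A C) *v v) \<le> ?s * norm v"
    if C: "C \<in> components D" for C v
  proof (rule spectral_proj_interval_difference[where N = N and e = e])
    note props = region_components(3)[OF D C]
    show "open C" "is_interval C" "C \<noteq> {}" using props by auto
    show "{i. lam i \<in> C} \<subseteq> N"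
    proof
      fix i assume "i \<in> {i. lam i \<in> C}"
      then have "set_edist (lam i) D \<le> ereal 0"
        using props set_edist_le[of "lam i" D "lam i"] by auto
      also have "\<dots> \<le> ereal (K * e)" using \<open>0 < K\<close> e by simp
      finally show "i \<in> N" by (simp add: N_def)
    qed
    show "d \<le> \<bar>lam i - p\<bar>" if "p \<in> frontier C" for i p
      using props that by (intro gap) auto
    show "K * e \<le> \<bar>lam i - y\<bar>" if "i \<notin> N" "y \<in> C" for i y
    proof -
      have "ereal (K * e) < set_edist (lam i) D" using that(1) by (simp add: N_def)
      also have "\<dots> \<le> ereal \<bar>lam i - y\<bar>" using props that(2) by (intro set_edist_le) auto
      finally show ?thesis by simp
    qed
    show "norm ((A + E - A) *v v) \<le> e * norm v" for v
      by (simp add: e_def norm_mult_le_spectral_norm)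
    show "\<bar>A.pr N v \<bullet> ((A + E - A) *v A.pr N w)\<bar> \<le> g * norm (A.pr N v) * norm (A.pr N w)" for v w
      unfolding g_eq using A.bilinear_block_bound[OF abs_le_dir_pert, of N v E w] by simp
  qed (fact e g \<open>0 < K\<close> \<open>0 < d\<close> d)+
  let ?C = "components D"
  have fin: "finite ?C" using D by (rule region_components)
  have dis: "disjoint ?C" 
    using pairwise_disjoint_components[of D] by (simp add: pairwise_def disjnt_def)
  have "spectral_proj (A + E) D - spectral_proj A D
      = spectral_proj (A + E) (\<Union>?C) - spectral_proj A (\<Union>?C)" by simp
  also have "\<dots> = (\<Sum>C\<in>?C. spectral_proj (A + E) C - spectral_proj A C)"
    by (simp only: A.spectral_proj_UNION[OF fin dis] B.spectral_proj_UNION[OF fin dis] sum_subtractf)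
  finally have eq: "spectral_proj (A + E) D - spectral_proj A D
      = (\<Sum>C\<in>?C. spectral_proj (A + E) C - spectral_proj A C)" .
  have mult_sum: "sum f S *v v = (\<Sum>C\<in>S. f C *v v)"
    for f :: "real set \<Rightarrow> real^'n^'n" and S v
    by (induction S rule: infinite_finite_induct) (simp_all add: matrix_vector_mult_add_rdistrib)
  show ?thesis unfolding spectral_norm_def
  proof (rule onorm_le)
    fix v
    have "norm ((spectral_proj (A + E) D - spectral_proj A D) *v v) \<le> (\<Sum>C\<in>?C. ?s * norm v)"
      unfolding eq mult_sum by (intro sum_norm_le comp)
    then show "norm ((spectral_proj (A + E) D - spectral_proj A D) *v v)
        \<le> real (num_components D) * ?s * norm v"
      by (simp add: num_components_def mult.assoc)
  qed
qed

text \<open>By connectedness of the line an empty frontier leaves only \<open>{}\<close> and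
  \<open>UNIV\<close>. The gap is then infinite, and the two projections of the theorem
  coincide.\<close>

lemma spectral_proj_trivial:
  assumes "transpose A = A" "frontier D = {}"
  shows "spectral_proj A D = (if D = {} then 0 else mat 1)"
proof -
  obtain lam u where "eigenbasis u A lam"
    using assms(1) by (rule symmetric_imp_eigenbasis)
  then interpret eigenbasis u A lam .
  have "D = {} \<or> D = UNIV" using assms(2) by (simp add: frontier_eq_empty)
  then show ?thesis
    by (auto simp: matrix_eq spectral_proj_mult pr_UNIV) (simp add: pr_def)
qed

section \<open>The two regimes of the gap\<close>

theorem theorem1p4:
  fixes A E :: "real^'n^'n" and lam :: "'n \<Rightarrow> real" and u :: "'n \<Rightarrow> real^'n"
    and D :: "real set" and K x :: real and r :: nat and \<delta> :: ereal
  assumes "transpose A = A" and "transpose E = E" and "E \<noteq> 0"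
    and "orthonormal_eigenbasis A lam u"
    and "is_region D"
    and "K > 0"
  defines "x \<equiv> dir_pert u E"
    and "\<delta> \<equiv> boundary_gap lam D"
    and "r \<equiv> near_count lam D (K * spectral_norm E)"
  assumes "\<delta> > 0"
    and "\<delta> \<ge> ereal (6 * max (spectral_norm E / K) (sqrt (real r * x * spectral_norm E)))"
  shows "(\<delta> \<ge> ereal (spectral_norm E) \<longrightarrow>
            ereal (spectral_norm (spectral_proj (A + E) D - spectral_proj A D))
              \<le> ereal (44 * ln (3 + spectral_norm A / spectral_norm E) * real (num_components D))
                 * (ereal (real r * x) / \<delta> + ereal (1 / K)))
       \<and> (\<delta> < ereal (spectral_norm E) \<longrightarrow>
            spectral_norm (spectral_proj (A + E) D - spectral_proj A D)
              \<le> 44 * ln (3 + spectral_norm A / real_of_ereal \<delta>) * real (num_components D)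
                 * (spectral_norm E / (K * real_of_ereal \<delta>)
                    + real r * x * spectral_norm E / (real_of_ereal \<delta>)\<^sup>2))"
proof -
  let ?e = "spectral_norm E" and ?c = "real (num_components D)"
  let ?P = "spectral_norm (spectral_proj (A + E) D - spectral_proj A D)"
  have e: "0 < ?e" using \<open>E \<noteq> 0\<close> by (rule spectral_norm_pos)
  have x0: "0 \<le> x"
    unfolding x_def using abs_le_dir_pert[of u undefined E undefined] by linarith
  \<comment> \<open>Since exp 1 is at most 3, the logarithmic factor is at least 1 and may be
    inserted into any nonnegative bound.\<close>
  have ln_ge: "1 \<le> ln (3 + t)" if "0 \<le> t" for t :: real
  proof -
    have "exp 1 \<le> 3 + t" using exp_le that by linarith
    then show ?thesis using that by (subst ln_ge_iff) auto
  qed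
  show ?thesis
  proof (cases "frontier D = {}")
    case True
    \<comment> \<open>An infimum over the empty set. Part (ii) becomes void, and in part (i) the
      quotient by \<open>\<delta>\<close> is 0.\<close>
    have "\<delta> = \<infinity>"
      by (simp add: \<delta>_def boundary_gap_def set_edist_def True top_ereal_def)
    have "transpose (A + E) = A + E"
      using assms(1,2) by (simp add: transpose_def vec_eq_iff)
    then have "spectral_proj (A + E) D = spectral_proj A D"
      using spectral_proj_trivial[OF _ True] assms(1) by metis
    moreover have "(*v) (0 :: real^'n^'n) = (\<lambda>v. 0)" by auto
    ultimately have P: "?P = 0" by (simp add: spectral_norm_def onorm_zero)
    have "0 \<le> 44 * ln (3 + spectral_norm A / ?e) * ?c * (1 / K)"
      using ln_ge[of "spectral_norm A / ?e"] e \<open>K > 0\<close> spectral_norm_nonneg[of A] by simp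
    with P \<open>\<delta> = \<infinity>\<close> show ?thesis by simp
  next
    case False
    then obtain p where p: "p \<in> frontier D" by blast
    have "\<delta> \<le> ereal \<bar>lam undefined - p\<bar>"
      unfolding \<delta>_def using p by (rule boundary_gap_le)
    with \<open>\<delta> > 0\<close> obtain d where \<delta>: "\<delta> = ereal d" and d: "0 < d"
      by (cases \<delta>) auto
    define g where "g = real r * x"
    have g: "0 \<le> g" using x0 by (simp add: g_def)
    have large: "6 * max (?e / K) (sqrt (g * ?e)) \<le> d"
      using assms(11) by (simp add: \<delta> g_def)
    then have "6 * (?e / K) \<le> d" by linarith
    then have d1: "6 * ?e \<le> K * d"
      using \<open>K > 0\<close> by (simp add: field_simps)
    have "6 * sqrt (g * ?e) \<le> d" using large by linarith
    then have "(6 * sqrt (g * ?e))\<^sup>2 \<le> d\<^sup>2"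
      using g e by (intro power_mono) auto
    then have d2: "36 * g * ?e \<le> d\<^sup>2"
      using g e by (simp add: power_mult_distrib)
    have gap: "d \<le> \<bar>lam i - p\<bar>" if "p \<in> frontier D" for i p
      using boundary_gap_le[OF that, of lam i] \<delta> by (simp add: \<delta>_def)
    have main: "?P \<le> ?c * (2 * (1 / K + (g + ?e / K) / d))"
      using spectral_proj_region_difference[OF assms(1,2,4,5) \<open>K > 0\<close> d \<open>E \<noteq> 0\<close> gap]
        d1 d2 by (simp add: g_def r_def x_def)
    \<comment> \<open>The common shape of both parts: \<open>main\<close> has the constant 2,
      comparison with \<open>X\<close> costs another 2, and 4 is below 44 times the
      logarithm.\<close>
    have absorb: "?P \<le> 44 * ln (3 + t) * ?c * X"
      if t: "0 \<le> t" and X: "1 / K + (g + ?e / K) / d \<le> 2 * X" for t X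
    proof -
      have "0 \<le> 1 / K + (g + ?e / K) / d" using \<open>K > 0\<close> d g e by simp
      then have X0: "0 \<le> X" using X by linarith
      have scale: "2 * a \<le> 44 * b" if "a \<le> 2 * b" "0 \<le> b" for a b :: real
        using that by linarith
      note main
      also have "?c * (2 * (1 / K + (g + ?e / K) / d)) \<le> ?c * (44 * X)"
          by (intro mult_left_mono scale X X0) simp
      also have "\<dots> = 44 * 1 * ?c * X" by simp
      also have "\<dots> \<le> 44 * ln (3 + t) * ?c * X"
        using ln_ge[OF t] X0 by (intro mult_right_mono mult_left_mono) auto
      finally show ?thesis .
    qed
    have expand: "1 / K + (g + ?e / K) / d = 1 / K + g / d + ?e / d / K"
      by (simp add: add_divide_distrib mult.commute)
    have gd: "0 \<le> g / d" using g d by simp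
    show ?thesis
    proof (intro conjI impI)
      assume "ereal ?e \<le> \<delta>"
      then have "?e / d \<le> 1" using d by (simp add: \<delta>)
      \<comment> \<open>The mixed term is absorbed by a second copy of \<open>1 / K\<close>.\<close>
      then have "?e / d / K \<le> 1 / K" using \<open>K > 0\<close> by (intro divide_right_mono) auto
      then have "1 / K + (g + ?e / K) / d \<le> 2 * (g / d + 1 / K)"
        unfolding expand distrib_left using gd by linarith
      then have "?P \<le> 44 * ln (3 + spectral_norm A / ?e) * ?c * (g / d + 1 / K)"
        using e spectral_norm_nonneg[of A] by (intro absorb) auto
      then show "ereal ?P \<le> ereal (44 * ln (3 + spectral_norm A / ?e) * ?c)
          * (ereal (real r * x) / \<delta> + ereal (1 / K))"
        using d by (simp add: \<delta> g_def)
    next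
      assume "\<delta> < ereal ?e"
      then have ed: "1 \<le> ?e / d" using d by (simp add: \<delta>)
      \<comment> \<open>Here the factor \<open>?e / d\<close> is at least 1, so multiplying
        \<open>1 / K\<close> and \<open>g / d\<close> by it gives the terms of part (ii).\<close>
      have "1 / K \<le> ?e / d / K" using ed \<open>K > 0\<close> by (intro divide_right_mono) auto
      moreover have "g / d * 1 \<le> g / d * (?e / d)"
        using ed g d by (intro mult_left_mono) auto
      ultimately have "1 / K + (g + ?e / K) / d \<le> 2 * (?e / d / K + g / d * (?e / d))"
        unfolding expand distrib_left using gd by linarith
      then have "1 / K + (g + ?e / K) / d \<le> 2 * (?e / (K * d) + g * ?e / d\<^sup>2)"
        by (simp add: mult.commute power2_eq_square)
      then show "?P \<le> 44 * ln (3 + spectral_norm A / real_of_ereal \<delta>) * ?c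
          * (?e / (K * real_of_ereal \<delta>) + real r * x * ?e / (real_of_ereal \<delta>)\<^sup>2)"
        using d spectral_norm_nonneg[of A]
          absorb[of "spectral_norm A / d" "?e / (K * d) + g * ?e / d\<^sup>2"]
        by (simp add: \<delta> g_def)
    qed
  qed
qed

end
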